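(* Let $2^p-1$ and $2^q-1$ be Mersenne primes with $p<q$. If $k$ is an integer with $k\geq (p-1)(q-1)$, then \[B(k)\geq 2^k(1-2^{-q})^{\frac{k-p(q-1)}{q}}(1-2^{-p})^{q-1}.\]
   Context: Let $\overline{\psi}$ be the multiplicative arithmetic function with $\overline{\psi}(p^{\alpha})=p^{\alpha-1}(p+1)$ for odd primes $p$ and $\overline{\psi}(2^{\alpha})=2^{\alpha-1}$, for all positive integers $\alpha$ (so $\overline{\psi}(1)=1$). For $n>1$, $\lambda(n)$ is the unique nonnegative integer with $\overline{\psi}^{\lambda(n)}(n)=2$ (where $\overline{\psi}^k$ is the $k$-th iterate, $\overline{\psi}^0(n)=n$), and $\lambda(1)=0$. For each nonnegative integer $k\neq 1$, $B(k)$ denotes the largest odd positive integer $n$ with $\lambda(n)=k$ (such a number exists). *)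

theory Defs
  imports Complex_Main "HOL-Computational_Algebra.Primes"
begin

definition psibar :: "nat \<Rightarrow> nat" where
  "psibar n = (\<Prod>p\<in>prime_factors n.
     if p = 2 then 2 ^ (multiplicity p n - 1)
     else p ^ (multiplicity p n - 1) * (p + 1))"

text \<open>The next three facts confirm that \<open>psibar\<close> is the multiplicative function with the
  prescribed values at prime powers.\<close>

lemma psibar_two_power: "\<alpha> > 0 \<Longrightarrow> psibar (2 ^ \<alpha>) = 2 ^ (\<alpha> - 1)"
  by (simp add: psibar_def prime_factorization_prime_power)

lemma psibar_odd_prime_power:
  assumes "prime p" "odd p" "\<alpha> > 0"
  shows "psibar (p ^ \<alpha>) = p ^ (\<alpha> - 1) * (p + 1)"
proof -
  have "prime_factors (p ^ \<alpha>) = {p}" "p \<noteq> 2"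
    using assms by (simp_all add: prime_factorization_prime_power) auto
  then show ?thesis
    using assms by (simp add: psibar_def prime_imp_prime_elem)
qed

lemma psibar_mult_coprime:
  assumes "coprime m n" "m > 0" "n > 0"
  shows "psibar (m * n) = psibar m * psibar n"
proof -
  let ?f = "\<lambda>n p. if p = 2 then 2 ^ (multiplicity p n - 1)
     else p ^ (multiplicity p n - 1) * (p + 1) :: nat"
  have disj: "prime_factors m \<inter> prime_factors n = {}"
    using assms(1) by (meson coprime_common_divisor disjoint_iff in_prime_factors_iff not_prime_unit)
  have mult: "multiplicity p (m * n) = multiplicity p m + multiplicity p n" if "prime p" for p
    using that assms by (simp add: prime_elem_multiplicity_mult_distrib)
  have m: "?f (m * n) p = ?f m p" if "p \<in> prime_factors m" for p
  proof -
    have "prime p" "\<not> p dvd n" using that disj assms by (auto simp: prime_factors_dvd)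
    then show ?thesis by (auto simp: mult not_dvd_imp_multiplicity_0)
  qed
  have n: "?f (m * n) p = ?f n p" if "p \<in> prime_factors n" for p
  proof -
    have "prime p" "\<not> p dvd m" using that disj assms by (auto simp: prime_factors_dvd)
    then show ?thesis by (auto simp: mult not_dvd_imp_multiplicity_0)
  qed
  have "psibar (m * n) = (\<Prod>p\<in>prime_factors m \<union> prime_factors n. ?f (m * n) p)"
    using assms by (simp add: psibar_def prime_factors_product)
  also have "\<dots> = (\<Prod>p\<in>prime_factors m. ?f (m * n) p) * (\<Prod>p\<in>prime_factors n. ?f (m * n) p)"
    by (rule prod.union_disjoint) (use disj in auto)
  also have "(\<Prod>p\<in>prime_factors m. ?f (m * n) p) = psibar m"
    unfolding psibar_def by (rule prod.cong[OF refl m])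
  also have "(\<Prod>p\<in>prime_factors n. ?f (m * n) p) = psibar n"
    unfolding psibar_def by (rule prod.cong[OF refl n])
  finally show ?thesis .
qed

text \<open>\<open>lam 0\<close> is unspecified; it is never used, since \<open>0\<close> is even.\<close>

definition lam :: "nat \<Rightarrow> nat" where
  "lam n = (if n = 1 then 0 else (THE k. (psibar ^^ k) n = 2))"

text \<open>\<open>B 1\<close> is meaningless: no odd \<open>n\<close> has \<open>lam n = 1\<close>.\<close>

definition B :: "nat \<Rightarrow> nat" where
  "B k = (GREATEST n. odd n \<and> lam n = k)"

end

theory Submission
  imports Defs "HOL-Number_Theory.Cong"
begin

text \<open>
  Let \<open>D\<close> be the completely additive function with \<open>D 2 = 1\<close> and \<open>D p = D (p + 1)\<close> for odd
  primes \<open>p\<close>. An application of \<open>psibar\<close> lowers \<open>D\<close> by one on even numbers and preserves it on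
  odd numbers, so \<open>lam\<close> agrees with \<open>D\<close> on odd numbers and is therefore additive there. As
  \<open>D (2 ^ p - 1) = p\<close> for a Mersenne prime, every odd number \<open>(2 ^ p - 1) ^ a * (2 ^ q - 1) ^ b\<close>
  with \<open>p * a + q * b = k\<close> is a lower bound for \<open>B k\<close>. Such \<open>a\<close> and \<open>b\<close> with \<open>a < q\<close> exist
  because \<open>k\<close> is at least \<open>(p - 1) * (q - 1)\<close>, and \<open>a = q - 1\<close> is the worst case since
  \<open>1 - 2 ^ - p \<le> (1 - 2 ^ - q) powr (p / q)\<close>.
\<close>

section \<open>The completely additive weight\<close>

text \<open>This is the \<open>D\<close> above. Recursing on \<open>Suc p div 2\<close> instead of
  \<open>Suc p\<close> keeps the argument below \<open>n\<close> even when \<open>n\<close> is the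
  prime \<open>p\<close> itself; the outer \<open>Suc\<close> pays for the factor 2 split
  off.\<close>

function weight :: "nat \<Rightarrow> nat" where
  "weight n = (\<Sum>p\<in>#prime_factorization n. if p = 2 then 1 else Suc (weight (Suc p div 2)))"
  by auto
termination
proof (relation "measure id", simp)
  fix n p :: nat
  assume "p \<in># prime_factorization n" "p \<noteq> 2"
  then have "prime p" "p dvd n" "n > 0"
    by (auto simp: in_prime_factors_iff)
  then have "p \<le> n" "p \<ge> 2"
    by (auto simp: dvd_imp_le prime_ge_2_nat)
  then show "(Suc p div 2, n) \<in> measure id"
    using \<open>p \<noteq> 2\<close> by auto
qed

declare weight.simps [simp del]

lemma weight_1 [simp]: "weight (Suc 0) = 0"
  by (simp add: weight.simps)

lemma weight_mult: "m > 0 \<Longrightarrow> n > 0 \<Longrightarrow> weight (m * n) = weight m + weight n"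
  unfolding weight.simps[of "m * n"] weight.simps[of m] weight.simps[of n]
  by (simp add: prime_factorization_mult)

lemma weight_power: "n > 0 \<Longrightarrow> weight (n ^ k) = k * weight n"
  by (induction k) (simp_all add: weight_mult)

lemma weight_2 [simp]: "weight 2 = 1"
  by (subst weight.simps) (simp add: prime_factorization_prime)

text \<open>Undoes the halving in the recursion and so recovers
  \<open>D p = D (p + 1)\<close>.\<close>

lemma weight_prime:
  assumes "prime p" "odd p"
  shows "weight p = weight (Suc p)"
proof -
  have "weight p = Suc (weight (Suc p div 2))"
    using assms by (subst weight.simps) (auto simp: prime_factorization_prime)
  also have "\<dots> = weight (2 * (Suc p div 2))"
    using prime_gt_0_nat[OF assms(1)] by (subst weight_mult) auto
  also have "2 * (Suc p div 2) = Suc p"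
    using assms by simp
  finally show ?thesis .
qed

lemma weight_prod: "(\<And>x. x \<in> A \<Longrightarrow> f x > 0) \<Longrightarrow> weight (prod f A) = (\<Sum>x\<in>A. weight (f x))"
proof (induction A rule: infinite_finite_induct)
  case (insert x A)
  have "prod f A > 0" using insert.prems by (intro prod_pos) auto
  then show ?case using insert by (simp add: weight_mult)
qed auto

lemma weight_eq_sum_multiplicity:
  assumes "n > 0"
  shows "weight n = (\<Sum>p\<in>prime_factors n. multiplicity p n * weight p)"
proof -
  have "weight n = weight (\<Prod>p\<in>prime_factors n. p ^ multiplicity p n)"
    using prime_factorization_nat[OF assms] by simp
  also have "\<dots> = (\<Sum>p\<in>prime_factors n. weight (p ^ multiplicity p n))"
    by (rule weight_prod) (auto simp: prime_gt_0_nat in_prime_factors_iff)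
  also have "\<dots> = (\<Sum>p\<in>prime_factors n. multiplicity p n * weight p)"
    by (rule sum.cong) (auto simp: weight_power prime_gt_0_nat in_prime_factors_iff)
  finally show ?thesis .
qed

text \<open>The bound is multiplicative, and it passes from half of \<open>Suc n\<close> to an odd
  prime \<open>n\<close> because both sides double. It later shows that \<open>B\<close> is a
  maximum over a bounded set.\<close>

lemma le_two_power_weight: "n > 0 \<Longrightarrow> n \<le> 2 ^ weight n"
proof (induction n rule: less_induct)
  case (less n)
  consider "n = 1" | "n = 2" | "prime n" "odd n" | "n > 1" "\<not> prime n"
    using less.prems primes_dvd_imp_eq[of 2 n] by (cases "n = 1"; cases "prime n") auto
  then show ?case
  proof cases
    case 3
    let ?m = "Suc n div 2"
    have "n \<ge> 3" using 3 prime_ge_2_nat[of n] by (cases "n = 2") auto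
    then have "?m \<le> 2 ^ weight ?m" by (intro less.IH) auto
    moreover have "Suc n = 2 * ?m" using 3 by simp
    moreover have "weight n = Suc (weight ?m)"
      using 3 \<open>n \<ge> 3\<close> weight_mult[of 2 ?m] weight_prime[of n] by simp
    ultimately show ?thesis by simp
  next
    case 4
    then obtain a where "a dvd n" "a \<noteq> 1" "a \<noteq> n"
      by (auto simp: prime_nat_iff)
    then obtain b where ab: "n = a * b" "1 < a" "a < n"
      using less.prems dvd_imp_le[of a n] by (cases a) auto
    then have "b < n" "b > 0" by (auto intro: Nat.gr0I)
    with ab have "a * b \<le> 2 ^ weight a * 2 ^ weight b"
      by (intro mult_mono less.IH) auto
    with ab \<open>b > 0\<close> show ?thesis by (simp add: weight_mult power_add)
  qed auto
qed

section \<open>Iterating \<open>psibar\<close>: weight, parity and \<open>lam\<close>\<close>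

lemma psibar_pos: "psibar n > 0"
  unfolding psibar_def by (intro prod_pos) (auto simp: in_prime_factors_iff prime_gt_0_nat)

text \<open>For each odd prime factor one \<open>p\<close> is traded for \<open>p + 1\<close>, which
  has the same weight; the power of 2, if present, loses one factor 2.\<close>

lemma weight_psibar:
  assumes "n > 0"
  shows "weight (psibar n) + (if even n then 1 else 0) = weight n"
proof -
  let ?f = "\<lambda>p. if p = 2 then 2 ^ (multiplicity p n - 1)
     else p ^ (multiplicity p n - 1) * (p + 1) :: nat"
  have f: "weight (?f p) + (if p = 2 then 1 else 0) = multiplicity p n * weight p"
    if "p \<in> prime_factors n" for p
  proof -
    from that have p: "prime p" "multiplicity p n > 0"
      by (auto simp: prime_factors_multiplicity)
    show ?thesis
    proof (cases "p = 2")
      case True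
      then show ?thesis using p by (simp add: weight_power)
    next
      case False
      then have "odd p" using p primes_dvd_imp_eq[of 2 p] by auto
      then have "weight (?f p) = (multiplicity p n - 1) * weight p + weight p"
        using p False by (simp add: weight_mult weight_power weight_prime prime_gt_0_nat
            del: mult_Suc_right)
      then show ?thesis using p False by (cases "multiplicity p n") simp_all
    qed
  qed
  have "weight (psibar n) = (\<Sum>p\<in>prime_factors n. weight (?f p))"
    unfolding psibar_def by (rule weight_prod) (auto simp: in_prime_factors_iff prime_gt_0_nat)
  moreover have "(if even n then 1 else 0) = (\<Sum>p\<in>prime_factors n. if p = 2 then 1 else 0 :: nat)"
    using assms by (simp add: in_prime_factors_iff)
  ultimately have "weight (psibar n) + (if even n then 1 else 0) =
      (\<Sum>p\<in>prime_factors n. weight (?f p) + (if p = 2 then 1 else 0))"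
    by (simp only: sum.distrib)
  also have "\<dots> = weight n"
    unfolding weight_eq_sum_multiplicity[OF assms] by (rule sum.cong[OF refl f])
  finally show ?thesis .
qed

text \<open>An odd prime factor \<open>p\<close> contributes the even factor \<open>p + 1\<close>.
  Otherwise \<open>n\<close> is a power of 2, which \<open>psibar\<close> halves unless it is
  1.\<close>

lemma even_psibar_iff:
  assumes "n > 0"
  shows "even (psibar n) \<longleftrightarrow> n \<noteq> 1 \<and> n \<noteq> 2"
proof (cases "\<exists>p\<in>prime_factors n. p \<noteq> 2")
  case True
  then obtain p where p: "p \<in> prime_factors n" "p \<noteq> 2" by blast
  then have "odd p" using primes_dvd_imp_eq[of 2 p] by (auto simp: in_prime_factors_iff)
  with p have "even (psibar n)"
    by (auto simp: psibar_def even_prod_iff intro!: bexI[of _ p])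
  moreover have "n \<noteq> 1" "n \<noteq> 2"
    using p by (auto simp: prime_factorization_prime)
  ultimately show ?thesis by simp
next
  case False
  then have "prime_factors n \<subseteq> {2}" by auto
  have "n = (\<Prod>p\<in>prime_factors n. p ^ multiplicity p n)"
    using prime_factorization_nat[OF assms] by simp
  also have "\<dots> = (\<Prod>p\<in>{2}. p ^ multiplicity p n)"
    using \<open>prime_factors n \<subseteq> {2}\<close>
    by (intro prod.mono_neutral_left) (auto simp: prime_factors_multiplicity)
  finally obtain e where n: "n = 2 ^ e" by simp
  show ?thesis
  proof (cases "e = 0")
    case True
    then show ?thesis by (simp add: n psibar_def)
  next
    case False
    then obtain e' where "e = Suc e'" using not0_implies_Suc by blast
    then show ?thesis using psibar_two_power[of e] by (cases e') (auto simp: n)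
  qed
qed

text \<open>Each step keeps the number even and lowers its weight by one until 2, of weight 1, is
  reached; hence the \<open>- 1\<close>.\<close>

lemma funpow_psibar_even:
  assumes "even n" "n > 0"
  shows "(psibar ^^ (weight n - 1)) n = 2"
  using assms
proof (induction "weight n" arbitrary: n rule: less_induct)
  case less
  show ?case
  proof (cases "n = 2")
    case False
    with less.prems have "even (psibar n)" by (auto simp: even_psibar_iff)
    have w: "weight n = Suc (weight (psibar n))"
      using weight_psibar[of n] less.prems by simp
    \<comment> \<open>The weight of \<open>psibar n\<close> has to be positive for the truncated
      \<open>- 1\<close> to count steps correctly.\<close>
    have "psibar n \<ge> 2" using \<open>even (psibar n)\<close> psibar_pos[of n] by (auto elim!: evenE)
    then have "2 \<le> (2::nat) ^ weight (psibar n)"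
      using le_two_power_weight[OF psibar_pos] order_trans by blast
    then have "weight (psibar n) \<noteq> 0" by (intro notI) simp
    then obtain d where d: "weight (psibar n) = Suc d" using not0_implies_Suc by blast
    have "(psibar ^^ (weight (psibar n) - 1)) (psibar n) = 2"
      using less.hyps[of "psibar n"] w \<open>even (psibar n)\<close> psibar_pos by simp
    then show ?thesis by (simp add: w d funpow_swap1)
  qed simp
qed

text \<open>After 2 every iterate is 1. This justifies the \<open>THE\<close> in
  \<open>lam\<close>.\<close>

lemma funpow_psibar_eq_2_unique:
  assumes "(psibar ^^ i) n = 2" "(psibar ^^ j) n = 2"
  shows "i = j"
proof -
  have less: False if "(psibar ^^ i) n = 2" "(psibar ^^ j) n = 2" and "i < j" for i j
  proof -
    have psibar_1: "psibar 1 = 1" and psibar_2: "psibar 2 = 1"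
      using psibar_two_power[of 1] by (simp_all add: psibar_def)
    have fix1: "(psibar ^^ m) 1 = 1" for m
      by (induction m) (use psibar_1 in simp_all)
    obtain d where d: "j = d + Suc i"
      using \<open>i < j\<close> by (metis add.commute add_Suc_right less_iff_Suc_add)
    have "(psibar ^^ j) n = (psibar ^^ d) (psibar ((psibar ^^ i) n))"
      by (simp add: d funpow_add funpow_swap1)
    then show False using that psibar_2 fix1 by simp
  qed
  show ?thesis using less assms by (metis linorder_neqE_nat)
qed

text \<open>For odd \<open>n > 1\<close> the first step preserves the weight and produces an even
  number, so it makes up for the \<open>- 1\<close> of the even case.\<close>

lemma lam_odd:
  assumes "odd n"
  shows "lam n = weight n"
proof (cases "n = 1")
  case False
  have "n > 0" using assms by (auto intro: Nat.gr0I)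
  have even: "even (psibar n)" using even_psibar_iff[OF \<open>n > 0\<close>] False assms by auto
  have w: "weight (psibar n) = weight n" using weight_psibar[OF \<open>n > 0\<close>] assms by simp
  have "n > 1" using False \<open>n > 0\<close> by simp
  then have "1 < (2::nat) ^ weight n"
    using le_two_power_weight[OF \<open>n > 0\<close>] by simp
  then obtain d where d: "weight n = Suc d" by (cases "weight n") auto
  have "(psibar ^^ weight n) n = 2"
    using funpow_psibar_even[OF even psibar_pos] by (simp add: w d funpow_swap1)
  then have "(THE k. (psibar ^^ k) n = 2) = weight n"
    using funpow_psibar_eq_2_unique by blast
  then show ?thesis using False by (simp add: lam_def)
qed (simp add: lam_def)

lemma le_B:
  assumes "odd n"
  shows "n \<le> B (weight n)"
  unfolding B_def
proof (rule Greatest_le_nat)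
  show "odd n \<and> lam n = weight n" using assms lam_odd by simp
  show "m \<le> 2 ^ weight n" if "odd m \<and> lam m = weight n" for m
    using that le_two_power_weight[of m] lam_odd[of m] by (auto intro: Nat.gr0I)
qed

section \<open>Mersenne primes\<close>

lemma weight_mersenne:
  assumes "prime (2 ^ p - 1 :: nat)"
  shows "weight (2 ^ p - 1) = p" and "odd (2 ^ p - 1 :: nat)"
proof -
  have "p \<noteq> 0" using assms by (intro notI) auto
  then show "odd (2 ^ p - 1 :: nat)" by simp
  with assms have "weight (2 ^ p - 1) = weight (2 ^ p)" by (simp add: weight_prime)
  then show "weight (2 ^ p - 1) = p" by (simp add: weight_power)
qed

lemma mersenne_dvd_mersenne:
  assumes "m dvd n"
  shows "2 ^ m - 1 dvd (2 ^ n - 1 :: nat)"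
proof -
  obtain c where "n = m * c" using assms by blast
  have "[2 ^ m = 1] (mod (2 ^ m - 1 :: nat))"
    by (simp add: cong_altdef_nat)
  then have "[(2 ^ m) ^ c = 1 ^ c] (mod (2 ^ m - 1 :: nat))" by (rule cong_pow)
  then show ?thesis by (simp add: \<open>n = m * c\<close> power_mult cong_altdef_nat)
qed

text \<open>With \<open>g\<close> the gcd of the exponents, \<open>2 ^ g - 1\<close> divides two
  distinct primes, so it is 1.\<close>

lemma coprime_mersenne_exponents:
  assumes "prime (2 ^ p - 1 :: nat)" "prime (2 ^ q - 1 :: nat)" "p < q"
  shows "coprime p q"
proof -
  let ?g = "gcd p q"
  have "(2::nat) ^ p - 1 < 2 ^ q - 1"
    using assms(3) by (intro diff_less_mono) auto
  then have "coprime (2 ^ p - 1 :: nat) (2 ^ q - 1)"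
    using assms by (intro primes_coprime) auto
  moreover have "2 ^ ?g - 1 dvd (2 ^ p - 1 :: nat)" "2 ^ ?g - 1 dvd (2 ^ q - 1 :: nat)"
    by (rule mersenne_dvd_mersenne, simp)+
  ultimately have "2 ^ ?g - 1 = (1::nat)"
    by (rule coprime_common_divisor_nat)
  then have "2 ^ ?g = (2 ^ 1 :: nat)" by simp
  then have "?g = 1" using power_inject_exp[of "2::nat" ?g 1] by simp
  then show ?thesis by (simp add: coprime_iff_gcd_eq_1)
qed

section \<open>Choice of exponents and the final estimate\<close>

text \<open>Take for \<open>a\<close> the residue of \<open>k / p\<close> modulo \<open>q\<close>.
  Then \<open>k - p * a\<close>, as an integer, is a multiple of \<open>q\<close> greater than
  \<open>-q\<close>, hence nonnegative.\<close>

lemma frobenius_two_coins: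
  fixes p q k :: nat
  assumes "coprime p q" "q > 0" "k \<ge> (p - 1) * (q - 1)"
  obtains a b where "k = p * a + q * b" "a < q"
proof -
  obtain y where "[p * y = 1] (mod q)"
    using cong_solve_coprime_nat[OF assms(1)] by auto
  then have x: "[p * (y * k) = k] (mod q)"
    using cong_scalar_right[of "p * y" 1 q k] by (simp add: mult.assoc)
  define a where "a = y * k mod q"
  have "a < q" using assms(2) by (simp add: a_def)
  have cong: "[p * a = k] (mod q)"
    using x by (simp add: a_def cong_def mod_mult_right_eq)
  have "p * a < k + q"
  proof (cases p)
    case (Suc p')
    have "p * a \<le> p * (q - 1)" using \<open>a < q\<close> by (intro mult_left_mono) auto
    also have "\<dots> = (p - 1) * (q - 1) + (q - 1)" by (simp add: Suc)
    also have "\<dots> < k + q" using assms(2,3) by linarith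
    finally show ?thesis .
  qed (use assms in simp)
  have "p * a \<le> k"
  proof (rule ccontr)
    assume "\<not> p * a \<le> k"
    then have "q dvd p * a - k"
      using cong by (simp add: cong_altdef_nat)
    then have "q \<le> p * a - k" using \<open>\<not> p * a \<le> k\<close> by (intro dvd_imp_le) auto
    with \<open>p * a < k + q\<close> \<open>\<not> p * a \<le> k\<close> show False by simp
  qed
  then have "q dvd k - p * a" using cong_sym[OF cong] by (simp add: cong_altdef_nat)
  then obtain b where "k - p * a = q * b" by blast
  with \<open>p * a \<le> k\<close> have "k = p * a + q * b" by simp
  then show thesis using \<open>a < q\<close> by (rule that)
qed

text \<open>The left side has \<open>c = q - 1 - a\<close> more factors \<open>x\<close> than the
  right. Each is at most \<open>y powr (p / q)\<close>, and trading them all raises the exponent of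
  \<open>y\<close> to exactly \<open>b\<close>.\<close>

lemma powr_exchange_le:
  fixes x y :: real and p q a b k :: nat
  assumes "0 < x" "x \<le> y" "y \<le> 1" "p \<le> q" "a < q" "k = p * a + q * b"
  shows "y powr ((real k - real p * (real q - 1)) / real q) * x ^ (q - 1) \<le> x ^ a * y ^ b"
proof -
  define c where "c = q - 1 - a"
  have q: "q = Suc (a + c)" using assms by (simp add: c_def)
  have "x \<le> y powr 1" using assms by simp
  also have "\<dots> \<le> y powr (real p / real q)"
    using assms q by (intro powr_mono') (auto simp: field_simps)
  finally have "x ^ c \<le> (y powr (real p / real q)) ^ c"
    using assms by (intro power_mono) auto
  also have "\<dots> = y powr (real c * real p / real q)"
    using assms by (simp add: powr_powr mult.commute flip: powr_realpow)
  finally have x: "x ^ c \<le> y powr (real c * real p / real q)" .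
  have e: "(real k - real p * (real q - 1)) / real q = real b - real c * real p / real q"
    using assms(6) by (simp add: q field_simps)
  have "y powr ((real k - real p * (real q - 1)) / real q) * x ^ (q - 1)
      = y powr (real b - real c * real p / real q) * (x ^ a * x ^ c)"
    unfolding e by (simp add: q power_add)
  also have "\<dots> \<le> y powr (real b - real c * real p / real q)
      * (x ^ a * y powr (real c * real p / real q))"
    using x assms by (intro mult_left_mono) auto
  also have "\<dots> = x ^ a * y powr real b"
    by (simp add: flip: powr_add)
  also have "y powr real b = y ^ b" using assms by (simp add: powr_realpow)
  finally show ?thesis .
qed

theorem theorem2p4:
  fixes p q k :: nat
  assumes "prime (2 ^ p - 1 :: nat)" and "prime (2 ^ q - 1 :: nat)"
    and "p < q"
    and "k \<ge> (p - 1) * (q - 1)"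
  shows "real (B k) \<ge> 2 ^ k
           * (1 - 1 / 2 ^ q) powr ((real k - real p * (real q - 1)) / real q)
           * (1 - 1 / 2 ^ p) ^ (q - 1)"
proof -
  have "coprime p q" using assms(1-3) by (rule coprime_mersenne_exponents)
  moreover have "q > 0" using assms(3) by simp
  ultimately obtain a b where k: "k = p * a + q * b" and "a < q"
    using assms(4) by (rule frobenius_two_coins)
  define n :: nat where "n = (2 ^ p - 1) ^ a * (2 ^ q - 1) ^ b"
  have "odd n" using assms(1,2)[THEN weight_mersenne(2)] by (simp add: n_def)
  have pos: "(2::nat) ^ p - 1 > 0" "(2::nat) ^ q - 1 > 0"
    using assms(1,2) by (simp_all only: prime_gt_0_nat)
  then have "weight n = k"
    by (simp add: n_def k weight_mult weight_power weight_mersenne(1)[OF assms(1)]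
        weight_mersenne(1)[OF assms(2)] mult.commute del: One_nat_def)
  have "p > 0" using pos by (intro Nat.gr0I) simp
  let ?x = "1 - 1 / 2 ^ p :: real" and ?y = "1 - 1 / 2 ^ q :: real"
  have "(1::real) < 2 ^ p" using \<open>p > 0\<close> by simp
  then have "0 < ?x" by simp
  have "(2::real) ^ p \<le> 2 ^ q" using assms(3) by (intro power_increasing) auto
  then have "?x \<le> ?y" by (simp add: frac_le)
  have "2 ^ k * ?y powr ((real k - real p * (real q - 1)) / real q) * ?x ^ (q - 1)
      \<le> 2 ^ k * (?x ^ a * ?y ^ b)"
    using powr_exchange_le[OF \<open>0 < ?x\<close> \<open>?x \<le> ?y\<close> _ _ \<open>a < q\<close> k] assms(3)
    by (simp add: mult.assoc)
  \<comment> \<open>Splitting \<open>2 ^ k\<close> along \<open>k = p * a + q * b\<close> turns the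
    factors into the Mersenne primes.\<close>
  also have "\<dots> = (2 ^ p * ?x) ^ a * (2 ^ q * ?y) ^ b"
    by (simp add: k power_add power_mult power_mult_distrib)
  also have "\<dots> = real n"
    by (simp add: n_def of_nat_diff right_diff_distrib)
  also have "\<dots> \<le> real (B k)"
    using le_B[OF \<open>odd n\<close>] \<open>weight n = k\<close> by simp
  finally show ?thesis .
qed

end
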